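(* Let $\mathbb{F}\in\{\mathbb{R},\mathbb{C}\}$, let $f_1,\dots,f_r\in\mathbb{F}\langle X\rangle_d$, and let $$\mathcal{S}=\mathrm{span}_{\mathbb{F}}\{\phi_A \mid n\in\mathbb{N},\ A\in M_n(\mathbb{F})^g,\ \phi_A(f_i)=0 \text{ for } 1\leq i\leq r\}\subseteq (\mathbb{F}\langle X\rangle_d)^*.$$ If $(L(w))_{w\in\langle X\rangle_d}$ is a constrained truncated tracial moment sequence (with respect to $f_1,\dots,f_r$) with $L(1)=1$, then the corresponding linear functional $L:\mathbb{F}\langle X\rangle_d\to\mathbb{F}$ belongs to $\mathcal{S}$.
   Context: $\langle X\rangle$ is the free monoid on noncommuting variables $x_1,\dots,x_g$ (its identity is the empty word $1$), $\mathbb{F}\langle X\rangle$ is the free associative unital algebra, $\langle X\rangle_d$ is the set of words of length at most $d$, and $\mathbb{F}\langle X\rangle_d$ is the space of polynomials of degree at most $d$. Two polynomials are cyclically equivalent if their difference is a sum of commutators in $\mathbb{F}\langle X\rangle$. For $A\in M_n(\mathbb{F})^g$ ($n\ge 1$), $\phi_A:\mathbb{F}\langle X\rangle_d\to\mathbb{F}$ is the linear functional $\phi_A(p)=\mathrm{tr}(p(A))$, where $\mathrm{tr}$ is the usual matrix trace and constants $c$ evaluate to $cI_n$. A sequence $(L(w))_{w\in\langle X\rangle_d}$ in $\mathbb{F}$ is a truncated tracial moment sequence if $L(v)=L(w)$ whenever the words $v,w\in\langle X\rangle_d$ are cyclically equivalent; it is identified with the linear functional $L$ on $\mathbb{F}\langle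 X\rangle_d$ obtained by linear extension. Given $f_i=\sum_j\lambda_{ij}w_j\in\mathbb{F}\langle X\rangle_d$ ($1\le i\le r$, $\lambda_{ij}\in\mathbb{F}$, $w_j\in\langle X\rangle_d$), the sequence is a constrained truncated tracial moment sequence if it is a truncated tracial moment sequence and $L(f_i)=\sum_j\lambda_{ij}L(w_j)=0$ for $1\leq i\leq r$. *)

theory Defs
  imports
    Complex_Main
    "HOL-Library.Poly_Mapping"
    "HOL-Library.Function_Algebras"
    "Jordan_Normal_Form.Matrix"
begin

text \<open>
  Words in noncommuting variables indexed by a type \<open>'x\<close>. The free monoid is written
  additively (\<open>+\<close> is concatenation, \<open>0\<close> the empty word) because \<^theory>\<open>HOL-Library.Poly_Mapping\<close>
  forms the monoid algebra of an additive, not necessarily commutative, monoid of exponents.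
\<close>

datatype 'x free_word = FWord (letters: "'x list")

instantiation free_word :: (type) monoid_add
begin

definition zero_free_word :: "'a free_word" where
  "0 = FWord []"

definition plus_free_word :: "'a free_word \<Rightarrow> 'a free_word \<Rightarrow> 'a free_word" where
  "v + w = FWord (letters v @ letters w)"

instance
  by standard (auto simp: zero_free_word_def plus_free_word_def)

end

type_synonym ('x, 'a) free_algebra = "'x free_word \<Rightarrow>\<^sub>0 'a"

definition words_upto :: "nat \<Rightarrow> 'x free_word set" where
  "words_upto d = {w. length (letters w) \<le> d}"

definition polys_upto :: "nat \<Rightarrow> ('x, 'a::zero) free_algebra set" where
  "polys_upto d = {p. Poly_Mapping.keys p \<subseteq> words_upto d}"

abbreviation monomial :: "'x free_word \<Rightarrow> ('x, 'a::zero_neq_one) free_algebra" where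
  "monomial w \<equiv> Poly_Mapping.single w 1"

definition cyc_equiv :: "('x, 'a::field) free_algebra \<Rightarrow> ('x, 'a) free_algebra \<Rightarrow> bool" where
  "cyc_equiv p q \<longleftrightarrow>
     (\<exists>(m::nat) (a :: nat \<Rightarrow> ('x, 'a) free_algebra) b.
        p - q = (\<Sum>k<m. a k * b k - b k * a k))"

definition word_eval :: "nat \<Rightarrow> ('x \<Rightarrow> 'a::field mat) \<Rightarrow> 'x free_word \<Rightarrow> 'a mat" where
  "word_eval n A w = foldr (\<lambda>x M. A x * M) (letters w) (1\<^sub>m n)"

text \<open>
  The matrix \<open>p(A)\<close> is the linear combination of the \<open>word_eval n A w\<close> with the coefficients of
  \<open>p\<close>. It is written entrywise because \<^typ>\<open>'a mat\<close> has no additive unit independent of the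
  dimension, so \<^const>\<open>sum\<close> is unavailable for matrices.
\<close>

definition poly_eval :: "nat \<Rightarrow> ('x \<Rightarrow> 'a::field mat) \<Rightarrow> ('x, 'a) free_algebra \<Rightarrow> 'a mat" where
  "poly_eval n A p =
     mat n n (\<lambda>ij. \<Sum>w\<in>Poly_Mapping.keys p. Poly_Mapping.lookup p w * (word_eval n A w $$ ij))"

definition mat_trace :: "'a::comm_monoid_add mat \<Rightarrow> 'a" where
  "mat_trace M = (\<Sum>i<dim_row M. M $$ (i, i))"

text \<open>
  Functionals on \<open>polys_upto d\<close> are represented by functions on the whole free algebra that
  are \<open>0\<close> outside \<open>polys_upto d\<close>. Such functions are determined by their restriction to
  \<open>polys_upto d\<close>, and pointwise addition and scaling preserve them, so spans
  are those in the dual space of \<open>polys_upto d\<close>.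
\<close>

definition trace_functional ::
    "nat \<Rightarrow> nat \<Rightarrow> ('x \<Rightarrow> 'a::field mat) \<Rightarrow> ('x, 'a) free_algebra \<Rightarrow> 'a" where
  "trace_functional d n A p = (if p \<in> polys_upto d then mat_trace (poly_eval n A p) else 0)"

definition linear_extension ::
    "nat \<Rightarrow> ('x free_word \<Rightarrow> 'a::field) \<Rightarrow> ('x, 'a) free_algebra \<Rightarrow> 'a" where
  "linear_extension d L p =
     (if p \<in> polys_upto d
      then \<Sum>w\<in>Poly_Mapping.keys p. Poly_Mapping.lookup p w * L w else 0)"

global_interpretation functional: vector_space
  "\<lambda>(c::'a::field) (\<phi> :: 'b \<Rightarrow> 'a) p. c * \<phi> p"
  by standard (auto simp: fun_eq_iff algebra_simps)

definition constrained_trace_span ::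
    "nat \<Rightarrow> nat \<Rightarrow> (nat \<Rightarrow> ('x, 'a::field) free_algebra) \<Rightarrow> (('x, 'a) free_algebra \<Rightarrow> 'a) set" where
  "constrained_trace_span d r f =
     functional.span {trace_functional d n A | n A.
       1 \<le> n \<and> (\<forall>x. A x \<in> carrier_mat n n) \<and> (\<forall>i\<in>{1..r}. trace_functional d n A (f i) = 0)}"

text \<open>
  A sequence indexed by \<open>words_upto d\<close> is a function on all words; only its values on
  \<open>words_upto d\<close> enter the definitions.
\<close>

definition truncated_tracial_moment_sequence :: "nat \<Rightarrow> ('x free_word \<Rightarrow> 'a::field) \<Rightarrow> bool" where
  "truncated_tracial_moment_sequence d L \<longleftrightarrow>
     (\<forall>v\<in>words_upto d. \<forall>w\<in>words_upto d.
        cyc_equiv (monomial v :: ('x, 'a) free_algebra) (monomial w) \<longrightarrow> L v = L w)"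

definition constrained_truncated_tracial_moment_sequence ::
    "nat \<Rightarrow> nat \<Rightarrow> (nat \<Rightarrow> ('x, 'a::field) free_algebra) \<Rightarrow> ('x free_word \<Rightarrow> 'a) \<Rightarrow> bool" where
  "constrained_truncated_tracial_moment_sequence d r f L \<longleftrightarrow>
     truncated_tracial_moment_sequence d L \<and> (\<forall>i\<in>{1..r}. linear_extension d L (f i) = 0)"

end

theory Submission
  imports
    Defs
    "HOL-Number_Theory.Cong"
begin

text \<open>
  A constrained sequence \<open>L\<close> with \<open>L 0 = 1\<close> is itself a multiple of a single trace functional:
  there are \<open>n\<close> and matrices \<open>A\<close> of size \<open>n\<close> with \<open>tr w(A) = n L(w)\<close> for all words of length at
  most \<open>d\<close>. To a word \<open>w\<close> of length \<open>l\<close> one attaches the adjacency matrices of an \<open>l\<close>-cycle whose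
  edges are labelled by the letters of \<open>w\<close>, with one edge of weight \<open>c\<close>. Shorter nonempty words
  have trace zero on it, and a word \<open>v\<close> of length \<open>l\<close> has trace \<open>c\<close> times the number of rotations
  taking \<open>w\<close> to \<open>v\<close>. So the traces can be prescribed length by length: a direct sum of cycles
  over all words of length \<open>l\<close> corrects the values in length \<open>l\<close> without disturbing shorter words.
  The size of the matrices does not depend on the prescribed values, so these may be \<open>n L(w)\<close>.
\<close>

section \<open>Sequences of word traces and their direct sums\<close>

definition trace_seq :: "nat \<Rightarrow> ('x \<Rightarrow> 'a::field mat) \<Rightarrow> 'x list \<Rightarrow> 'a" where
  "trace_seq n A v = mat_trace (word_eval n A (FWord v))"

text \<open>The size \<open>n\<close> is kept as an index because it is the value at the empty word
  and adds up under direct sums.\<close>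

definition trace_seqs :: "nat \<Rightarrow> ('x list \<Rightarrow> 'a::field) set" where
  "trace_seqs n = {trace_seq n A | A. \<forall>x. A x \<in> carrier_mat n n}"

lemma word_eval_Nil [simp]: "word_eval n A (FWord []) = 1\<^sub>m n"
  and word_eval_Cons [simp]: "word_eval n A (FWord (x # v)) = A x * word_eval n A (FWord v)"
  by (simp_all add: word_eval_def)

lemma word_eval_carrier:
  assumes "\<And>x. A x \<in> carrier_mat n n"
  shows "word_eval n A (FWord v) \<in> carrier_mat n n"
  by (induction v) (simp_all add: mult_carrier_mat[OF assms])

lemma word_eval_append:
  assumes "\<And>x. A x \<in> carrier_mat n n"
  shows "word_eval n A (FWord (u @ v)) = word_eval n A (FWord u) * word_eval n A (FWord v)"
proof (induction u)
  case Nil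
  show ?case using word_eval_carrier[of A n v, OF assms] by simp
next
  case (Cons x u)
  show ?case
    using assoc_mult_mat[OF assms word_eval_carrier[of A n u, OF assms]
        word_eval_carrier[of A n v, OF assms]]
    by (simp add: Cons.IH)
qed

lemma mat_trace_comm:
  fixes M :: "'a::field mat"
  assumes "M \<in> carrier_mat n m" "N \<in> carrier_mat m n"
  shows "mat_trace (M * N) = mat_trace (N * M)"
proof -
  have "mat_trace (M * N) = (\<Sum>i<n. \<Sum>j<m. M $$ (i, j) * N $$ (j, i))"
    using assms by (auto simp: mat_trace_def scalar_prod_def atLeast0LessThan intro!: sum.cong)
  also have "\<dots> = (\<Sum>j<m. \<Sum>i<n. N $$ (j, i) * M $$ (i, j))"
    by (subst sum.swap) (simp add: mult.commute)
  also have "\<dots> = mat_trace (N * M)"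
    using assms by (auto simp: mat_trace_def scalar_prod_def atLeast0LessThan intro!: sum.cong)
  finally show ?thesis .
qed

lemma mat_trace_four_block:
  fixes M :: "'a::field mat"
  assumes "M \<in> carrier_mat n n" "N \<in> carrier_mat m m"
  shows "mat_trace (four_block_mat M B C N) = mat_trace M + mat_trace N"
proof -
  have "mat_trace (four_block_mat M B C N) =
      (\<Sum>i<n + m. if i < n then M $$ (i, i) else N $$ (i - n, i - n))"
    using assms by (auto simp: mat_trace_def intro!: sum.cong)
  \<comment> \<open>The fresh bound \<open>k\<close> lets the induction run while the matrix
    \<open>N\<close> stays fixed.\<close>
  also have "(\<Sum>i<n + k. if i < n then M $$ (i, i) else N $$ (i - n, i - n))
      = (\<Sum>i<n. M $$ (i, i)) + (\<Sum>i<k. N $$ (i, i))" for k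
    by (induction k) (auto simp: add.assoc)
  finally show ?thesis using assms by (simp add: mat_trace_def)
qed

text \<open>Cyclicity of the trace; it keeps the error rotation invariant when traces are corrected
  length by length.\<close>

lemma trace_seq_rotate:
  assumes "\<phi> \<in> trace_seqs n"
  shows "\<phi> (rotate j v) = \<phi> v"
proof -
  obtain A where A: "\<And>x. A x \<in> carrier_mat n n" and \<phi>: "\<phi> = trace_seq n A"
    using assms by (auto simp: trace_seqs_def)
  have "\<phi> (b @ a) = \<phi> (a @ b)" for a b
    using mat_trace_comm[OF word_eval_carrier[of A n a] word_eval_carrier[of A n b]] A
    by (simp add: \<phi> trace_seq_def word_eval_append)
  then show ?thesis
    by (metis append_take_drop_id rotate_drop_take)
qed

lemma trace_seqs_Nil: "\<phi> \<in> trace_seqs n \<Longrightarrow> \<phi> [] = of_nat n"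
  by (auto simp: trace_seqs_def trace_seq_def mat_trace_def)

lemma trace_seqs_zero:
  "(\<lambda>v :: 'x list. if v = [] then of_nat n else 0 :: 'a::field) \<in> trace_seqs n"
proof -
  let ?Z = "\<lambda>_ :: 'x. 0\<^sub>m n n :: 'a mat"
  have "trace_seq n ?Z v = (if v = [] then of_nat n else 0)" for v :: "'x list"
  proof (cases v)
    case (Cons x u)
    then show ?thesis
      using left_mult_zero_mat[OF word_eval_carrier[of ?Z n u]]
      by (simp add: trace_seq_def mat_trace_def)
  qed (simp add: trace_seq_def mat_trace_def)
  then show ?thesis
    unfolding trace_seqs_def by (auto intro!: exI[of _ ?Z])
qed

text \<open>Block diagonal matrices multiply blockwise, so the traces of the two blocks add for
  every word.\<close>

lemma trace_seqs_add:
  assumes "\<phi> \<in> trace_seqs n" "\<psi> \<in> trace_seqs m"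
  shows "(\<lambda>v. \<phi> v + \<psi> v) \<in> trace_seqs (n + m)"
proof -
  obtain A where A: "\<And>x. A x \<in> carrier_mat n n" and \<phi>: "\<phi> = trace_seq n A"
    using assms(1) by (auto simp: trace_seqs_def)
  obtain B where B: "\<And>x. B x \<in> carrier_mat m m" and \<psi>: "\<psi> = trace_seq m B"
    using assms(2) by (auto simp: trace_seqs_def)
  define D where "D x = four_block_mat (A x) (0\<^sub>m n m) (0\<^sub>m m n) (B x)" for x
  have "word_eval (n + m) D (FWord v) =
      four_block_mat (word_eval n A (FWord v)) (0\<^sub>m n m) (0\<^sub>m m n) (word_eval m B (FWord v))" for v
  proof (induction v)
    case Nil
    show ?case by simp
  next
    case (Cons x v)
    show ?case
      using A[of x] B[of x] word_eval_carrier[of A n v, OF A] word_eval_carrier[of B m v, OF B]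
      by (simp add: Cons.IH D_def[of x] mult_four_block_mat[where ?nr1.0 = n and ?n1.0 = n and ?n2.0 = m and ?nr2.0 = m and ?nc1.0 = n and ?nc2.0 = m])
  qed
  then have "trace_seq (n + m) D v = \<phi> v + \<psi> v" for v
    using mat_trace_four_block[OF word_eval_carrier[of A n v, OF A] word_eval_carrier[of B m v, OF B]]
    by (simp add: trace_seq_def \<phi> \<psi>)
  moreover have "\<forall>x. D x \<in> carrier_mat (n + m) (n + m)"
    using A B by (auto simp: D_def)
  ultimately show ?thesis
    unfolding trace_seqs_def by (auto simp: fun_eq_iff intro!: exI[of _ D])
qed

lemma trace_seqs_sum:
  fixes \<phi> :: "'i \<Rightarrow> 'x list \<Rightarrow> 'a::field"
  assumes "finite I" "\<And>i. i \<in> I \<Longrightarrow> \<phi> i \<in> trace_seqs (n i)"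
  shows "(\<lambda>v. \<Sum>i\<in>I. \<phi> i v) \<in> trace_seqs (\<Sum>i\<in>I. n i)"
  using assms
proof (induction I rule: finite_induct)
  case empty
  \<comment> \<open>In size 0 both branches of the conditional are zero, which gives the empty
    sum.\<close>
  show ?case using trace_seqs_zero[of 0, where 'x = 'x and 'a = 'a] by (simp cong: if_cong)
qed (auto intro: trace_seqs_add)

section \<open>Weighted labelled cycles\<close>

text \<open>Adjacency matrix of the edges labelled \<open>x\<close> in a directed cycle spelling
  \<open>w\<close>; \<open>t i\<close> is the weight of the edge leaving vertex
  \<open>i\<close>.\<close>

definition cycle_mat :: "(nat \<Rightarrow> 'a::field) \<Rightarrow> 'x list \<Rightarrow> 'x \<Rightarrow> 'a mat" where
  "cycle_mat t w x = mat (length w) (length w)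
     (\<lambda>(i, j). if j = Suc i mod length w \<and> w ! i = x then t i else 0)"

text \<open>The entry sums the weights of walks from \<open>i\<close> to \<open>j\<close> spelling
  \<open>v\<close>. Each vertex has a single outgoing edge, so there is at most one such walk;
  removing its first step moves the start to \<open>Suc i mod length w\<close>.\<close>

lemma word_eval_cycle_mat:
  assumes "i < length w" "j < length w"
  shows "word_eval (length w) (cycle_mat t w) (FWord v) $$ (i, j) =
    (if j = (i + length v) mod length w \<and> (\<forall>k<length v. w ! ((i + k) mod length w) = v ! k)
     then \<Prod>k<length v. t ((i + k) mod length w) else 0)"
  using assms
proof (induction v arbitrary: i)
  case Nil
  then show ?case by auto
next
  case (Cons x v)
  let ?l = "length w" and ?M = "word_eval (length w) (cycle_mat t w) (FWord v)"
  have M: "?M \<in> carrier_mat ?l ?l"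
    by (rule word_eval_carrier) (simp add: cycle_mat_def)
  have s: "Suc i mod ?l < ?l" using Cons.prems by (intro mod_less_divisor) auto
  have "word_eval ?l (cycle_mat t w) (FWord (x # v)) $$ (i, j)
      = (\<Sum>k<?l. (if k = Suc i mod ?l \<and> w ! i = x then t i else 0) * ?M $$ (k, j))"
    using Cons.prems M
    by (auto simp: cycle_mat_def scalar_prod_def atLeast0LessThan intro!: sum.cong)
  also have "\<dots> = (\<Sum>k<?l. if k = Suc i mod ?l then (if w ! i = x then t i * ?M $$ (k, j) else 0) else 0)"
    by (intro sum.cong) auto
  also have "\<dots> = (if w ! i = x then t i * ?M $$ (Suc i mod ?l, j) else 0)"
    using s by simp
  also have "\<dots> = (if j = (i + length (x # v)) mod ?l \<and>
      (\<forall>k<length (x # v). w ! ((i + k) mod ?l) = (x # v) ! k)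
     then \<Prod>k<length (x # v). t ((i + k) mod ?l) else 0)"
  proof -
    have "(\<forall>k<length (x # v). w ! ((i + k) mod ?l) = (x # v) ! k) \<longleftrightarrow>
        w ! i = x \<and> (\<forall>k<length v. w ! ((Suc i mod ?l + k) mod ?l) = v ! k)"
      using Cons.prems(1) by (simp add: All_less_Suc2 mod_simps)
    moreover have "(\<Prod>k<length (x # v). t ((i + k) mod ?l)) =
        t i * (\<Prod>k<length v. t ((Suc i mod ?l + k) mod ?l))"
      using Cons.prems(1)
      by (simp add: prod.lessThan_Suc_shift mod_simps del: prod.lessThan_Suc)
    moreover have "(i + length (x # v)) mod ?l = (Suc i mod ?l + length v) mod ?l"
      by (simp add: mod_simps)
    ultimately show ?thesis
      unfolding Cons.IH[OF s Cons.prems(2)] by (auto simp only: mult_zero_right split: if_split)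
  qed
  finally show ?case .
qed

text \<open>A full turn of the cycle traverses every edge once, wherever it starts.\<close>

lemma prod_mod_shift:
  fixes t :: "nat \<Rightarrow> 'a::comm_monoid_mult"
  shows "(\<Prod>k<l. t ((i + k) mod l)) = (\<Prod>k<l. t k)"
proof -
  have inj: "inj_on (\<lambda>k. (i + k) mod l) {..<l}"
  proof (rule inj_onI)
    fix a b assume "a \<in> {..<l}" "b \<in> {..<l}" "(i + a) mod l = (i + b) mod l"
    then show "a = b"
      using cong_add_lcancel_nat[of i a b l] cong_less_modulus_unique_nat[of a b l]
      by (auto simp: cong_def)
  qed
  moreover have "(\<lambda>k. (i + k) mod l) ` {..<l} = {..<l}"
    using inj by (cases "l = 0") (simp, intro endo_inj_surj, auto)
  ultimately have "bij_betw (\<lambda>k. (i + k) mod l) {..<l} {..<l}"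
    by (simp add: bij_betw_def)
  then show ?thesis by (rule prod.reindex_bij_betw)
qed

text \<open>The trace sums the weights of closed walks. These have length divisible by
  \<open>length w\<close>, and the single turn from vertex \<open>j\<close> spells
  \<open>rotate j w\<close>.\<close>

lemma trace_seqs_cycle:
  fixes c :: "'a::field"
  assumes "w \<noteq> []"
  shows "\<exists>\<phi>. \<phi> \<in> trace_seqs (length w) \<and>
    (\<forall>v. v \<noteq> [] \<longrightarrow> length v < length w \<longrightarrow> \<phi> v = 0) \<and>
    (\<forall>v. length v = length w \<longrightarrow> \<phi> v = (\<Sum>j<length w. if rotate j w = v then c else 0))"
proof (intro exI conjI allI impI)
  \<comment> \<open>Only the edge leaving vertex 0 carries \<open>c\<close>, so a full turn has
    weight \<open>c\<close> and no root of \<open>c\<close> has to be taken.\<close>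
  define t where "t i = (if i = 0 then c else 1)" for i :: nat
  let ?l = "length w" and ?\<phi> = "trace_seq (length w) (cycle_mat t w)"
  have C: "\<And>x. cycle_mat t w x \<in> carrier_mat ?l ?l" by (simp add: cycle_mat_def)
  show "?\<phi> \<in> trace_seqs ?l" using C by (auto simp: trace_seqs_def)
  have tr: "?\<phi> v = (\<Sum>i<?l. word_eval ?l (cycle_mat t w) (FWord v) $$ (i, i))" for v
    using word_eval_carrier[of "cycle_mat t w" ?l v] C by (simp add: trace_seq_def mat_trace_def)
  show "?\<phi> v = 0" if v: "v \<noteq> []" "length v < ?l" for v
  proof -
    have "word_eval ?l (cycle_mat t w) (FWord v) $$ (i, i) = 0" if "i < ?l" for i
    proof -
      \<comment> \<open>A positive length below the cycle length is not a multiple of it, so no walk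
        returns to its start.\<close>
      have "\<not> [i + length v = i] (mod ?l)"
        using v by (simp add: cong_add_lcancel_0_nat cong_0_iff nat_dvd_not_less)
      then have "i \<noteq> (i + length v) mod ?l" unfolding cong_def using that by (metis mod_less)
      then show ?thesis by (simp only: word_eval_cycle_mat[OF that that] simp_thms if_False)
    qed
    then show ?thesis unfolding tr by (intro sum.neutral) simp
  qed
  show "?\<phi> v = (\<Sum>j<?l. if rotate j w = v then c else 0)" if v: "length v = ?l" for v
  proof -
    have "(\<Prod>k<?l. t k) = c"
      using assms by (cases w) (auto simp: t_def prod.lessThan_Suc_shift simp del: prod.lessThan_Suc)
    then have "(\<Prod>k<?l. t ((i + k) mod ?l)) = c" for i
      by (simp only: prod_mod_shift)
    moreover have "(\<forall>k<?l. w ! ((i + k) mod ?l) = v ! k) \<longleftrightarrow> rotate i w = v" for i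
    proof -
      have "rotate i w = v \<longleftrightarrow> (\<forall>k<?l. rotate i w ! k = v ! k)"
        by (simp only: list_eq_iff_nth_eq length_rotate v simp_thms)
      then show ?thesis by (simp only: nth_rotate cong: imp_cong)
    qed
    ultimately show ?thesis
      unfolding tr using v by (intro sum.cong) (simp_all add: word_eval_cycle_mat)
  qed
qed

section \<open>Prescribing traces length by length\<close>

text \<open>Every word \<open>w\<close> of length \<open>l\<close> gets its own cycle, of weight
  \<open>c w / of_nat l\<close>. Over all these cycles, each of the \<open>l\<close> starting
  positions contributes \<open>c v / of_nat l\<close> at \<open>v\<close>; characteristic zero
  permits the division.\<close>

lemma trace_seqs_homogeneous:
  fixes c :: "'x::finite list \<Rightarrow> 'a::field_char_0"
  assumes "l > 0" and inv: "\<forall>v j. length v = l \<longrightarrow> c (rotate j v) = c v"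
  shows "\<exists>\<phi>. \<phi> \<in> trace_seqs (l * card {w :: 'x list. length w = l}) \<and>
    (\<forall>v. v \<noteq> [] \<longrightarrow> length v < l \<longrightarrow> \<phi> v = 0) \<and> (\<forall>v. length v = l \<longrightarrow> \<phi> v = c v)"
proof -
  let ?W = "{w :: 'x list. length w = l}"
  have fin: "finite ?W" using finite_lists_length_eq[of "UNIV :: 'x set" l] by simp
  have "\<forall>w\<in>?W. \<exists>\<phi>. \<phi> \<in> trace_seqs l \<and> (\<forall>v. v \<noteq> [] \<longrightarrow> length v < l \<longrightarrow> \<phi> v = 0) \<and>
     (\<forall>v. length v = l \<longrightarrow> \<phi> v = (\<Sum>j<l. if rotate j w = v then c w / of_nat l else 0))"
  proof
    fix w assume "w \<in> ?W"
    then have "w \<noteq> []" and l: "length w = l" using \<open>l > 0\<close> by auto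
    from trace_seqs_cycle[OF this(1), of "c w / of_nat l"]
    show "\<exists>\<phi>. \<phi> \<in> trace_seqs l \<and> (\<forall>v. v \<noteq> [] \<longrightarrow> length v < l \<longrightarrow> \<phi> v = 0) \<and>
     (\<forall>v. length v = l \<longrightarrow> \<phi> v = (\<Sum>j<l. if rotate j w = v then c w / of_nat l else 0))"
      unfolding l .
  qed
  from bchoice[OF this] obtain \<phi> where P:
    "\<forall>w\<in>?W. \<phi> w \<in> trace_seqs l \<and> (\<forall>v. v \<noteq> [] \<longrightarrow> length v < l \<longrightarrow> \<phi> w v = 0) \<and>
     (\<forall>v. length v = l \<longrightarrow> \<phi> w v = (\<Sum>j<l. if rotate j w = v then c w / of_nat l else 0))" ..
  have \<phi>: "\<phi> w \<in> trace_seqs l"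
    "v \<noteq> [] \<Longrightarrow> length v < l \<Longrightarrow> \<phi> w v = 0"
    "length v = l \<Longrightarrow> \<phi> w v = (\<Sum>j<l. if rotate j w = v then c w / of_nat l else 0)"
    if "w \<in> ?W" for w v
    using bspec[OF P that] by simp_all
  show ?thesis
  proof (intro exI conjI allI impI)
    show "(\<lambda>v. \<Sum>w\<in>?W. \<phi> w v) \<in> trace_seqs (l * card ?W)"
      using trace_seqs_sum[OF fin, of \<phi> "\<lambda>_. l"] \<phi>(1) by (simp add: mult.commute)
    show "(\<Sum>w\<in>?W. \<phi> w v) = 0" if "v \<noteq> []" "length v < l" for v
      using \<phi>(2) that by simp
    show "(\<Sum>w\<in>?W. \<phi> w v) = c v" if v: "length v = l" for v
    proof -
      \<comment> \<open>For fixed \<open>j\<close>, rotation permutes the words of length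
        \<open>l\<close>, so exactly one \<open>w\<close> contributes, and invariance turns
        \<open>c w\<close> into \<open>c v\<close>. Periodic words thus need no separate
        case.\<close>
      have one: "(\<Sum>w\<in>?W. if rotate j w = v then c w / of_nat l else 0) = c v / of_nat l" for j
      proof -
        have "inj_on (rotate j) ?W"
          unfolding rotate_def by (rule inj_on_subset[OF inj_fn[OF inj_rotate1] subset_UNIV])
        moreover have "rotate j ` ?W \<subseteq> ?W" by auto
        ultimately have bij: "bij_betw (rotate j) ?W ?W"
          unfolding bij_betw_def using endo_inj_surj[OF fin] by blast
        have "(\<Sum>w\<in>?W. if rotate j w = v then c w / of_nat l else 0)
            = (\<Sum>w\<in>?W. if rotate j w = v then c v / of_nat l else 0)"
          using inv by (intro sum.cong refl if_cong) auto
        also have "\<dots> = (\<Sum>u\<in>?W. if u = v then c v / of_nat l else 0)"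
          by (rule sum.reindex_bij_betw[OF bij])
        also have "\<dots> = c v / of_nat l" using v fin by simp
        finally show ?thesis .
      qed
      have "(\<Sum>w\<in>?W. \<phi> w v) = (\<Sum>j<l. \<Sum>w\<in>?W. if rotate j w = v then c w / of_nat l else 0)"
        by (subst sum.swap) (intro sum.cong refl \<phi>(3) v)
      then show ?thesis using \<open>l > 0\<close> by (simp add: one)
    qed
  qed
qed

text \<open>The empty word is left out, its trace being fixed by the size. The quantifier order
  allows targets that depend on \<open>n\<close>.\<close>

lemma trace_seqs_prescribed:
  "\<exists>n\<ge>1. \<forall>L :: 'x::finite list \<Rightarrow> 'a::field_char_0.
     (\<forall>v j. length v \<le> d \<longrightarrow> L (rotate j v) = L v) \<longrightarrow>
     (\<exists>\<phi>\<in>trace_seqs n. \<forall>v. v \<noteq> [] \<longrightarrow> length v \<le> d \<longrightarrow> \<phi> v = L v)"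
proof (induction d)
  case 0
  \<comment> \<open>No nonempty word has length 0; size 1 instead of 0 keeps \<open>n\<close>
    positive, so that it can be inverted later.\<close>
  show ?case using trace_seqs_zero[of 1] by (intro exI[of _ 1]) auto
next
  case (Suc d)
  then obtain n where "n \<ge> 1" and IH: "\<And>L :: 'x list \<Rightarrow> 'a.
      (\<And>v j. length v \<le> d \<Longrightarrow> L (rotate j v) = L v) \<Longrightarrow>
      \<exists>\<phi>\<in>trace_seqs n. \<forall>v. v \<noteq> [] \<longrightarrow> length v \<le> d \<longrightarrow> \<phi> v = L v"
    by blast
  let ?m = "n + Suc d * card {w :: 'x list. length w = Suc d}"
  have "\<exists>\<phi>\<in>trace_seqs ?m. \<forall>v. v \<noteq> [] \<longrightarrow> length v \<le> Suc d \<longrightarrow> \<phi> v = L v"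
    if L: "\<forall>v j. length v \<le> Suc d \<longrightarrow> L (rotate j v) = L v" for L :: "'x list \<Rightarrow> 'a"
  proof -
    have "\<exists>\<phi>\<in>trace_seqs n. \<forall>v. v \<noteq> [] \<longrightarrow> length v \<le> d \<longrightarrow> \<phi> v = L v"
      using L by (intro IH) simp
    then obtain \<phi> where \<phi>: "\<phi> \<in> trace_seqs n" "\<forall>v. v \<noteq> [] \<longrightarrow> length v \<le> d \<longrightarrow> \<phi> v = L v" ..
    have inv: "\<forall>v j. length v = Suc d \<longrightarrow> L (rotate j v) - \<phi> (rotate j v) = L v - \<phi> v"
      using L by (simp add: trace_seq_rotate[OF \<phi>(1)])
    obtain \<psi> where \<psi>: "\<psi> \<in> trace_seqs (Suc d * card {w :: 'x list. length w = Suc d})"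
      "\<forall>v. v \<noteq> [] \<longrightarrow> length v < Suc d \<longrightarrow> \<psi> v = 0"
      "\<forall>v. length v = Suc d \<longrightarrow> \<psi> v = L v - \<phi> v"
      using trace_seqs_homogeneous[of "Suc d" "\<lambda>v. L v - \<phi> v", OF zero_less_Suc inv]
      by (elim exE conjE)
    have "\<phi> v + \<psi> v = L v" if "v \<noteq> []" "length v \<le> Suc d" for v
      using \<phi>(2) \<psi>(2,3) that by (cases "length v = Suc d") simp_all
    then show ?thesis by (intro bexI[OF _ trace_seqs_add[OF \<phi>(1) \<psi>(1)]]) simp
  qed
  then show ?case using \<open>n \<ge> 1\<close> by (intro exI[of _ ?m]) auto
qed

section \<open>From word traces to functionals\<close>

text \<open>Rotation exchanges two factors of a word, so the difference is a single commutator. This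
  turns the tracial condition into rotation invariance.\<close>

lemma cyc_equiv_rotate:
  "cyc_equiv (monomial (FWord (rotate j v)) :: ('x, 'a::field) free_algebra) (monomial (FWord v))"
proof -
  obtain a b where ab: "v = a @ b" "rotate j v = b @ a"
    using append_take_drop_id[of "j mod length v" v] rotate_drop_take[of j v] by metis
  let ?a = "monomial (FWord a) :: ('x, 'a) free_algebra"
  let ?b = "monomial (FWord b) :: ('x, 'a) free_algebra"
  have "monomial (FWord (rotate j v)) - monomial (FWord v) = (\<Sum>k<1::nat. ?b * ?a - ?a * ?b)"
    unfolding ab(2) by (simp add: ab(1) mult_single plus_free_word_def)
  then show ?thesis unfolding cyc_equiv_def by (intro exI)
qed

lemma mat_trace_poly_eval:
  assumes "\<And>x. A x \<in> carrier_mat n n"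
  shows "mat_trace (poly_eval n A p) =
    (\<Sum>w\<in>Poly_Mapping.keys p. Poly_Mapping.lookup p w * mat_trace (word_eval n A w))"
proof -
  have "dim_row (word_eval n A w) = n" for w
    using word_eval_carrier[of A n "letters w"] assms by simp
  then show ?thesis
    by (simp add: mat_trace_def poly_eval_def sum_distrib_left) (rule sum.swap)
qed

text \<open>The matrices found satisfy the constraints automatically: their trace functional is
  \<open>n\<close> times \<open>linear_extension d L\<close>, which vanishes at each
  \<open>f i\<close>.\<close>

lemma linear_extension_in_constrained_trace_span:
  fixes f :: "nat \<Rightarrow> ('x::finite, 'a::field_char_0) free_algebra"
  assumes L: "constrained_truncated_tracial_moment_sequence d r f L" and "L 0 = 1"
  shows "linear_extension d L \<in> constrained_trace_span d r f"
proof -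
  have rot: "L (FWord (rotate j v)) = L (FWord v)" if "length v \<le> d" for v j
  proof -
    have "FWord v \<in> words_upto d" "FWord (rotate j v) \<in> words_upto d"
      using that by (simp_all add: words_upto_def)
    then show ?thesis
      using L cyc_equiv_rotate[of j v, where 'a = 'a]
      unfolding constrained_truncated_tracial_moment_sequence_def
        truncated_tracial_moment_sequence_def by blast
  qed
  obtain n where "n \<ge> 1" and n: "\<And>L :: 'x list \<Rightarrow> 'a.
      (\<And>v j. length v \<le> d \<Longrightarrow> L (rotate j v) = L v) \<Longrightarrow>
      \<exists>\<phi>\<in>trace_seqs n. \<forall>v. v \<noteq> [] \<longrightarrow> length v \<le> d \<longrightarrow> \<phi> v = L v"
    using trace_seqs_prescribed[of d] by blast
  obtain \<phi> where \<phi>: "\<phi> \<in> trace_seqs n"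
    "\<And>v. v \<noteq> [] \<Longrightarrow> length v \<le> d \<Longrightarrow> \<phi> v = of_nat n * L (FWord v)"
    using n[of "\<lambda>v. of_nat n * L (FWord v)"] rot by auto
  then obtain A where A: "\<And>x. A x \<in> carrier_mat n n" and "\<phi> = trace_seq n A"
    by (auto simp: trace_seqs_def)
  \<comment> \<open>At the empty word the trace is \<open>n\<close>, which agrees with the target
    because \<open>L 0 = 1\<close>.\<close>
  have tr: "mat_trace (word_eval n A w) = of_nat n * L w" if "w \<in> words_upto d" for w
  proof (cases w)
    case (FWord v)
    then show ?thesis
      using \<phi>(2)[of v] trace_seqs_Nil[OF \<phi>(1)] that \<open>L 0 = 1\<close> \<open>\<phi> = trace_seq n A\<close>
      by (cases "v = []") (auto simp: words_upto_def trace_seq_def zero_free_word_def)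
  qed
  have eq: "trace_functional d n A p = of_nat n * linear_extension d L p" for p
    using tr by (auto simp: trace_functional_def linear_extension_def mat_trace_poly_eval[OF A]
        polys_upto_def sum_distrib_left intro!: sum.cong)
  have "trace_functional d n A \<in> constrained_trace_span d r f"
    unfolding constrained_trace_span_def
    using L A \<open>n \<ge> 1\<close>
    by (intro functional.span_base CollectI exI[of _ n] exI[of _ A])
      (auto simp: constrained_truncated_tracial_moment_sequence_def eq)
  then have "(\<lambda>p. inverse (of_nat n) * trace_functional d n A p) \<in> constrained_trace_span d r f"
    unfolding constrained_trace_span_def by (rule functional.span_scale)
  moreover have "(\<lambda>p. inverse (of_nat n) * trace_functional d n A p) = linear_extension d L"
    using \<open>n \<ge> 1\<close> by (simp add: eq fun_eq_iff)
  ultimately show ?thesis by simp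
qed

text \<open>Both fields have characteristic zero, so the general result applies to each.\<close>

theorem corollary4p2:
  shows
    "(\<forall>(d::nat) (r::nat) (f :: nat \<Rightarrow> ('x::finite, real) free_algebra) (L :: 'x free_word \<Rightarrow> real).
        (\<forall>i\<in>{1..r}. f i \<in> polys_upto d) \<longrightarrow>
        constrained_truncated_tracial_moment_sequence d r f L \<longrightarrow>
        L 0 = 1 \<longrightarrow>
        linear_extension d L \<in> constrained_trace_span d r f) \<and>
     (\<forall>(d::nat) (r::nat) (f :: nat \<Rightarrow> ('x, complex) free_algebra) (L :: 'x free_word \<Rightarrow> complex).
        (\<forall>i\<in>{1..r}. f i \<in> polys_upto d) \<longrightarrow>
        constrained_truncated_tracial_moment_sequence d r f L \<longrightarrow>
        L 0 = 1 \<longrightarrow>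
        linear_extension d L \<in> constrained_trace_span d r f)"
  by (auto intro: linear_extension_in_constrained_trace_span)

end
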